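(* Let $X$ be a real random variable having a log-concave density $f$. Then $X$ is central moment bounded with parameter $L=\frac{1}{\ln 2}\mathbb E[|X-\mathbb E[X]|]$; moreover $L\le \frac{2}{\ln 2}\mathbb E[|X|]$.
   Context: A real random variable $Z$ is central moment bounded with parameter $L>0$ if for every integer $i\ge 1$, $\mathbb E[|Z-\mathbb E[Z]|^i]\le i\cdot L\cdot \mathbb E[|Z-\mathbb E[Z]|^{i-1}]$ (with $|\cdot|^0=1$). A non-negative function $f:\mathbb R\to\mathbb R$ is log-concave if $f(\lambda x+(1-\lambda)y)\ge f(x)^\lambda f(y)^{1-\lambda}$ for all $0\le\lambda\le1$ and $x,y\in\mathbb R$. "Density" means density with respect to Lebesgue measure on $\mathbb R$. *)

theory Defs
  imports "HOL-Probability.Probability"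
begin

(* The convention "0 powr 0 = 0" is harmless here: for l = 0 and l = 1 the inequality
   is trivially true whatever value is given to 0^0. *)
definition log_concave :: "(real \<Rightarrow> real) \<Rightarrow> bool" where
  "log_concave f \<longleftrightarrow>
     (\<forall>x. 0 \<le> f x) \<and>
     (\<forall>l x y. 0 \<le> l \<and> l \<le> 1 \<longrightarrow>
        f (l * x + (1 - l) * y) \<ge> f x powr l * f y powr (1 - l))"

(* The Bochner integral of a non-integrable function is 0, so the existence of the mean and
   the finiteness of all absolute central moments, implicit in the moment inequalities,
   are demanded explicitly. *)
definition central_moment_bounded :: "'a measure \<Rightarrow> ('a \<Rightarrow> real) \<Rightarrow> real \<Rightarrow> bool" where
  "central_moment_bounded M Z L \<longleftrightarrow>
     L > 0 \<and>
     integrable M Z \<and>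
     (\<forall>i::nat. integrable M (\<lambda>\<omega>. \<bar>Z \<omega> - (\<integral>\<omega>'. Z \<omega>' \<partial>M)\<bar> ^ i)) \<and>
     (\<forall>i::nat. i \<ge> 1 \<longrightarrow>
        (\<integral>\<omega>. \<bar>Z \<omega> - (\<integral>\<omega>'. Z \<omega>' \<partial>M)\<bar> ^ i \<partial>M)
          \<le> real i * L * (\<integral>\<omega>. \<bar>Z \<omega> - (\<integral>\<omega>'. Z \<omega>' \<partial>M)\<bar> ^ (i - 1) \<partial>M))"

end

theory Submission
  imports Defs
begin

text \<open>
  Let \<open>g\<close> be the density of \<open>Y = X - E X\<close>, and write \<open>p = P(Y \<ge> 0)\<close>,
  \<open>r = E Y\<^sup>+ = E \<bar>Y\<bar> / 2\<close>, \<open>T(x) = P(Y \<ge> x)\<close>, \<open>R(x) = E (Y - x)\<^sup>+\<close>.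
  Log-concavity makes the hazard rate \<open>g / T\<close> increasing, so Chebyshev's integral inequality
  compares the integrals of \<open>s ^ k\<close> against \<open>T\<close> and \<open>g\<close> on the half-line:
  \<open>p * E (Y\<^sup>+) ^ (k + 1) \<le> (k + 1) * r * E (Y\<^sup>+) ^ k\<close>.
  It remains to see that \<open>p \<ge> ln 2 / 2\<close>. The same inequality shows that \<open>T / R\<close> is
  increasing, hence \<open>-R' = T \<le> (p / r) * R\<close> left of the origin, so \<open>R\<close> grows there at most
  exponentially with rate \<open>p / r\<close>; comparing with \<open>R(x) \<ge> -x\<close> at \<open>x = -r / p\<close> bounds
  \<open>p\<close> from below. The reflected density handles \<open>Y\<^sup>-\<close>, and the two halves add up.
\<close>

section \<open>One-sided integrals of a density\<close>

definition tail :: "(real \<Rightarrow> real) \<Rightarrow> real \<Rightarrow> real" where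
  "tail g x = (\<integral>v. indicator {x..} v * g v \<partial>lborel)"

text \<open>As \<open>0 ^ 0 = 1\<close>, index 0 gives the full mass of the half-line. For the
  centred density, indices 0 and 1 are the \<open>p\<close> and \<open>r\<close> of the
  overview.\<close>

definition half_moment :: "(real \<Rightarrow> real) \<Rightarrow> nat \<Rightarrow> real" where
  "half_moment g k = (\<integral>x. indicator {0..} x * x ^ k * g x \<partial>lborel)"

text \<open>The integrated tail, or stop-loss transform; formally its derivative is minus
  \<open>tail g\<close>.\<close>

definition excess :: "(real \<Rightarrow> real) \<Rightarrow> real \<Rightarrow> real" where
  "excess g x = (\<integral>v. indicator {x..} v * (v - x) * g v \<partial>lborel)"

section \<open>Log-concavity and the four-point inequality\<close>

lemma log_concave_nonneg: "log_concave f \<Longrightarrow> 0 \<le> f x"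
  by (simp add: log_concave_def)

lemma log_concaveD:
  "log_concave f \<Longrightarrow> 0 \<le> l \<Longrightarrow> l \<le> 1 \<Longrightarrow> f x powr l * f y powr (1 - l) \<le> f (l * x + (1 - l) * y)"
  by (simp add: log_concave_def)

lemma log_concave_affine:
  assumes "log_concave f"
  shows "log_concave (\<lambda>x. f (a + c * x))"
  unfolding log_concave_def
proof (intro conjI allI impI)
  fix l x y :: real
  assume "0 \<le> l \<and> l \<le> 1"
  moreover have "a + c * (l * x + (1 - l) * y) = l * (a + c * x) + (1 - l) * (a + c * y)"
    by (simp add: algebra_simps)
  ultimately show "f (a + c * x) powr l * f (a + c * y) powr (1 - l) \<le> f (a + c * (l * x + (1 - l) * y))"
    using log_concaveD[OF assms] by metis
qed (simp add: log_concave_nonneg[OF assms])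

lemma log_concave_reflect: "log_concave f \<Longrightarrow> log_concave (\<lambda>x. f (- x))"
  using log_concave_affine[of f 0 "-1"] by simp

lemma lborel_integrable_reflect:
  fixes f :: "real \<Rightarrow> real"
  shows "integrable lborel f \<Longrightarrow> integrable lborel (\<lambda>x. f (- x))"
  using lborel_integrable_real_affine[of f "-1" 0] by simp

text \<open>The inner points \<open>u + h\<close> and \<open>v\<close> are convex combinations of
  the outer points \<open>u\<close> and \<open>v + h\<close> with swapped weights, so multiplying
  the two log-concavity inequalities restores full powers. Equivalently, a ratio of translates of
  \<open>f\<close> is monotone.\<close>

lemma log_concave_four_point:
  assumes f: "log_concave f" and uv: "u \<le> v" and h: "0 \<le> h"
  shows "f u * f (v + h) \<le> f (u + h) * f v"
proof (cases "u = v \<or> h = 0")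
  case True
  then show ?thesis by (auto simp: mult.commute)
next
  case False
  define l where "l = (v - u) / (v + h - u)"
  have d: "v + h - u > 0" using False uv h by linarith
  have l: "0 \<le> l" "l \<le> 1" using d uv h by (auto simp: l_def field_simps)
  have ld: "l * (v + h - u) = v - u" using d by (simp add: l_def)
  have e1: "l * u + (1 - l) * (v + h) = u + h" and e2: "(1 - l) * u + (1 - (1 - l)) * (v + h) = v"
    using ld by (simp_all add: algebra_simps)
  \<comment> \<open>At \<open>x = 0\<close> both factors vanish, since \<open>0 powr a = 0\<close>
    for every exponent.\<close>
  have p: "x powr l * x powr (1 - l) = x" if "0 \<le> x" for x :: real
    using that by (cases "x = 0") (simp_all flip: powr_add)
  have i1: "f u powr l * f (v + h) powr (1 - l) \<le> f (u + h)"
    using log_concaveD[OF f l, of u "v + h"] by (simp only: e1)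
  have i2: "f u powr (1 - l) * f (v + h) powr l \<le> f v"
    using log_concaveD[OF f, of "1 - l" u "v + h"] l by (simp only: e2) simp
  have "f u * f (v + h) = (f u powr l * f u powr (1 - l)) * (f (v + h) powr l * f (v + h) powr (1 - l))"
    using log_concave_nonneg[OF f] by (simp add: p)
  also have "\<dots> = (f u powr l * f (v + h) powr (1 - l)) * (f u powr (1 - l) * f (v + h) powr l)"
    by (simp add: mult_ac)
  also have "\<dots> \<le> f (u + h) * f v"
    using i1 i2 log_concave_nonneg[OF f] by (intro mult_mono) auto
  finally show ?thesis .
qed

section \<open>Exponential decay and finite moments\<close>

text \<open>Otherwise \<open>f\<close> would stay above \<open>f u\<close> on the whole ray from
  \<open>u\<close>, and its integral would exceed every multiple of \<open>f u\<close>.\<close>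

lemma integrable_nonneg_decreases:
  fixes f :: "real \<Rightarrow> real"
  assumes f: "integrable lborel f" and nn: "\<And>x. 0 \<le> f x" and u: "0 < f u"
  obtains w where "u < w" "f w < f u"
proof (rule ccontr)
  assume "\<not> thesis"
  then have ge: "f u \<le> f w" if "u \<le> w" for w
    using that \<open>\<not> thesis\<close> \<open>\<And>w. u < w \<Longrightarrow> f w < f u \<Longrightarrow> thesis\<close>
    by (metis less_eq_real_def not_less)
  obtain n :: nat where n: "(\<integral>x. f x \<partial>lborel) < n * f u"
    using ex_less_of_nat_mult[OF u] by blast
  have "n * f u = (\<integral>x. indicator {u..u + n} x * f u \<partial>lborel)"
    by simp
  also have "\<dots> \<le> (\<integral>x. f x \<partial>lborel)"
    using f ge nn by (intro integral_mono) (auto simp: integrable_mult_left split: split_indicator)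
  finally show False using n by simp
qed

text \<open>The Gamma integral with value \<open>fact k\<close> at rate 1, rescaled to rate
  \<open>c\<close>.\<close>

lemma integrable_power_times_exp:
  fixes c :: real
  assumes c: "0 < c"
  shows "integrable lborel (\<lambda>x. indicator {0..} x * x ^ k * exp (- c * x))"
proof -
  have "(\<integral>\<^sup>+x. ennreal (indicator {0..} x * (x ^ k * exp (- x))) \<partial>lborel) = ennreal (fact k)"
    unfolding nn_intergal_power_times_exp_Ici[of k, unfolded of_nat_fact, symmetric]
    by (auto intro!: nn_integral_cong split: split_indicator)
  then have "integrable lborel (\<lambda>x::real. indicator {0..} x * (x ^ k * exp (- x)))"
    by (intro integrableI_nn_integral_finite[where x = "fact k"])
       (auto split: split_indicator)
  from lborel_integrable_real_affine[OF this, of c 0]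
  have "integrable lborel (\<lambda>x. inverse (c ^ k) * (indicator {0..} (c * x) * ((c * x) ^ k * exp (- (c * x)))))"
    using c by simp
  then show ?thesis
    by (rule Bochner_Integration.integrable_cong[THEN iffD1, rotated -1])
       (use c in \<open>auto simp: power_mult_distrib zero_le_mult_iff split: split_indicator\<close>)
qed

text \<open>One strict drop of \<open>f\<close> suffices: beyond it, concavity of the logarithm
  forces decay at least at the rate of that drop, so an exponential dominates
  \<open>f\<close>.\<close>

lemma log_concave_integrable_half_moment:
  assumes f: "log_concave f" "integrable lborel f"
  shows "integrable lborel (\<lambda>x. indicator {0..} x * x ^ k * f x)"
proof (cases "\<exists>u. 0 < f u")
  case False
  then have "f = (\<lambda>x. 0)"
    using log_concave_nonneg[OF f(1)] by (auto simp: fun_eq_iff not_less intro: antisym)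
  then show ?thesis by simp
next
  case True
  note nn = log_concave_nonneg[OF f(1)]
  have [measurable]: "f \<in> borel_measurable borel"
    using f(2) borel_measurable_integrable by force
  obtain u where u: "0 < f u" using True by blast
  obtain w where w: "u < w" "f w < f u"
    using integrable_nonneg_decreases[OF f(2) nn u] .
  \<comment> \<open>\<open>f w\<close> may be 0; the maximum with \<open>f u / 2\<close> keeps
    \<open>ln q\<close> meaningful and \<open>q\<close> still below \<open>f u\<close>. The rate
    \<open>c\<close> is then minus the slope of the chord from \<open>(u, ln (f u))\<close> to
    \<open>(w, ln q)\<close>.\<close>
  define q where "q = max (f w) (f u / 2)"
  have q: "0 < q" "q < f u" "f w \<le> q" using u w by (auto simp: q_def)
  define c where "c = ln (f u / q) / (w - u)"
  have c: "0 < c" using q w by (auto simp: c_def intro!: divide_pos_pos ln_gt_zero)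
  have bound: "f y \<le> f u * exp (- c * (y - u))" if y: "w \<le> y" for y
  proof (cases "f y = 0")
    case True
    then show ?thesis using u by simp
  next
    case False
    then have fy: "0 < f y" using nn[of y] by simp
    define l where "l = (y - w) / (y - u)"
    have d: "y - u > 0" using y w by simp
    have l: "0 \<le> l" "l \<le> 1" using d y w by (auto simp: l_def field_simps)
    have ld: "l * (y - u) = y - w" using d by (simp add: l_def)
    \<comment> \<open>\<open>w\<close> lies between \<open>u\<close> and \<open>y\<close>, so the
      value at \<open>w\<close> bounds the weighted geometric mean of \<open>f u\<close> and
      \<open>f y\<close>; solving for \<open>f y\<close> extends the chord beyond
      \<open>w\<close>.\<close>
    have e: "l * u + (1 - l) * y = w" using ld by (simp add: algebra_simps)
    have "f u powr l * f y powr (1 - l) \<le> q"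
      using log_concaveD[OF f(1) l, of u y] q by (simp only: e)
    then have "ln (f u powr l * f y powr (1 - l)) \<le> ln q"
      using u fy q by (intro ln_mono) auto
    then have "l * ln (f u) + (1 - l) * ln (f y) \<le> ln q"
      using u fy by (simp add: ln_mult ln_powr)
    then have "(l * ln (f u) + (1 - l) * ln (f y)) * (y - u) \<le> ln q * (y - u)"
      using d by (intro mult_right_mono) auto
    moreover have "(l * ln (f u) + (1 - l) * ln (f y)) * (y - u)
        = (l * (y - u)) * ln (f u) + ((y - u) - l * (y - u)) * ln (f y)"
      by (simp add: algebra_simps)
    ultimately have "(y - w) * ln (f u) + (w - u) * ln (f y) \<le> ln q * (y - u)"
      by (simp add: ld)
    then have "(w - u) * ln (f y) \<le> (w - u) * ln (f u) - (ln (f u) - ln q) * (y - u)"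
      by (simp add: algebra_simps)
    also have "\<dots> = (w - u) * (ln (f u) - c * (y - u))"
      using w q u by (simp add: c_def ln_div right_diff_distrib)
    finally have "ln (f y) \<le> ln (f u) + - c * (y - u)"
      using w by simp
    then have "exp (ln (f y)) \<le> exp (ln (f u) + - c * (y - u))" by (simp only: exp_le_cancel_iff)
    then show ?thesis using u fy by (simp only: exp_add exp_ln)
  qed
  \<comment> \<open>The first summand dominates on the part of the half-line left of
    \<open>w\<close>, the second from \<open>w\<close> onwards.\<close>
  have int: "integrable lborel (\<lambda>x. \<bar>w\<bar> ^ k * f x
      + f u * exp (c * u) * (indicator {0..} x * x ^ k * exp (- c * x)))"
    using f(2) integrable_power_times_exp[OF c, of k] by simp
  show ?thesis
  proof (rule Bochner_Integration.integrable_bound[OF int])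
    have "\<bar>indicator {0..} x * x ^ k * f x\<bar> \<le> \<bar>\<bar>w\<bar> ^ k * f x
      + f u * exp (c * u) * (indicator {0..} x * x ^ k * exp (- c * x))\<bar>" for x
    proof (cases "0 \<le> x \<and> w \<le> x")
      case True
      have "x ^ k * f x \<le> x ^ k * (f u * exp (- c * (x - u)))"
        using True bound by (intro mult_left_mono) auto
      also have "\<dots> = f u * exp (c * u) * (x ^ k * exp (- c * x))"
        by (simp add: algebra_simps flip: exp_add)
      also have "\<dots> \<le> \<bar>w\<bar> ^ k * f x + f u * exp (c * u) * (x ^ k * exp (- c * x))"
        using nn by simp
      finally show ?thesis using True nn[of x] by simp
    next
      case False
      show ?thesis
      proof (cases "0 \<le> x")
        case True
        then have "x ^ k \<le> \<bar>w\<bar> ^ k" using False by (intro power_mono) auto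
        then have "x ^ k * f x \<le> \<bar>w\<bar> ^ k * f x" using nn by (intro mult_right_mono) auto
        moreover have "0 \<le> f u * exp (c * u) * (x ^ k * exp (- c * x))"
          using True u by simp
        ultimately show ?thesis using True nn[of x] by simp
      qed simp
    qed
    then show "AE x in lborel. norm (indicator {0..} x * x ^ k * f x) \<le> norm (\<bar>w\<bar> ^ k * f x
      + f u * exp (c * u) * (indicator {0..} x * x ^ k * exp (- c * x)))" by simp
  qed measurable
qed

section \<open>Chebyshev's integral inequality\<close>

text \<open>Integrating the pointwise inequality over both variables counts each product of integrals
  twice.\<close>
lemma Chebyshev_integral_inequality:
  fixes A B \<phi> :: "'a \<Rightarrow> real"
  assumes int: "integrable M A" "integrable M B" "integrable M (\<lambda>x. \<phi> x * A x)" "integrable M (\<lambda>x. \<phi> x * B x)"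
    and le: "\<And>s t. 0 \<le> (\<phi> s - \<phi> t) * (A s * B t - A t * B s)"
  shows "(\<integral>x. \<phi> x * B x \<partial>M) * (\<integral>x. A x \<partial>M) \<le> (\<integral>x. \<phi> x * A x \<partial>M) * (\<integral>x. B x \<partial>M)"
proof -
  define a b a' b' where "a = (\<integral>x. A x \<partial>M)" and "b = (\<integral>x. B x \<partial>M)"
    and "a' = (\<integral>x. \<phi> x * A x \<partial>M)" and "b' = (\<integral>x. \<phi> x * B x \<partial>M)"
  \<comment> \<open>The double integral is taken as two single ones: over \<open>s\<close> with
    \<open>t\<close> fixed here, then over \<open>t\<close>.\<close>
  have "b' * A t + a * (\<phi> t * B t) \<le> a' * B t + b * (\<phi> t * A t)" for t
  proof -
    have "b' * A t + a * (\<phi> t * B t) = (\<integral>s. (\<phi> s * B s) * A t + A s * (\<phi> t * B t) \<partial>M)"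
      using int by (simp add: a_def b'_def)
    also have "\<dots> \<le> (\<integral>s. (\<phi> s * A s) * B t + B s * (\<phi> t * A t) \<partial>M)"
    proof (rule integral_mono)
      show "\<phi> s * B s * A t + A s * (\<phi> t * B t) \<le> \<phi> s * A s * B t + B s * (\<phi> t * A t)" for s
        using le[of s t] by (simp add: algebra_simps)
    qed (use int in simp_all)
    also have "\<dots> = a' * B t + b * (\<phi> t * A t)"
      using int by (simp add: a'_def b_def)
    finally show ?thesis .
  qed
  then have "(\<integral>t. b' * A t + a * (\<phi> t * B t) \<partial>M) \<le> (\<integral>t. a' * B t + b * (\<phi> t * A t) \<partial>M)"
    using int by (intro integral_mono) auto
  then have "b' * a + a * b' \<le> a' * b + b * a'"
    using int by (simp add: a_def b_def a'_def b'_def)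
  then show ?thesis by (simp add: a_def b_def a'_def b'_def mult.commute)
qed

section \<open>Half-line moments and the hazard rate\<close>

lemma integrable_indicator_mult:
  fixes g :: "'a \<Rightarrow> real"
  shows "integrable M g \<Longrightarrow> S \<in> sets M \<Longrightarrow> integrable M (\<lambda>x. indicator S x * g x)"
  using integrable_real_mult_indicator[of S M g] by (simp add: mult.commute)

text \<open>Moving the origin to \<open>x\<close> puts tails at different points on one half-line,
  where their integrands can be compared pointwise.\<close>

lemma tail_shift: "tail g x = (\<integral>v. indicator {0..} v * g (x + v) \<partial>lborel)"
  unfolding tail_def
  by (subst lborel_integral_real_affine[where c = 1 and t = x]) (auto intro!: Bochner_Integration.integral_cong split: split_indicator)

lemma excess_shift: "excess g x = (\<integral>v. v * (indicator {0..} v * g (x + v)) \<partial>lborel)"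
  unfolding excess_def
  by (subst lborel_integral_real_affine[where c = 1 and t = x]) (auto intro!: Bochner_Integration.integral_cong split: split_indicator)

text \<open>Tonelli on the region \<open>0 \<le> s \<le> v\<close>: for fixed \<open>v\<close> the
  inner integral of \<open>s ^ k\<close> is \<open>v ^ Suc k / Suc k\<close>.\<close>

lemma integral_power_tail:
  assumes nn: "\<And>x. 0 \<le> g x" and g: "integrable lborel g"
    and m: "integrable lborel (\<lambda>x. indicator {0..} x * x ^ Suc k * g x)"
  shows "has_bochner_integral lborel (\<lambda>s. indicator {0..} s * s ^ k * tail g s)
    (half_moment g (Suc k) / Suc k)"
proof (rule has_bochner_integral_nn_integral)
  have [measurable]: "g \<in> borel_measurable borel"
    using g borel_measurable_integrable by force
  \<comment> \<open>The conditional is jointly measurable in \<open>x\<close> and \<open>v\<close>,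
    which yields measurability of \<open>tail g\<close> as a parameter integral.\<close>
  have t: "tail g = (\<lambda>x. \<integral>v. (if x \<le> v then g v else 0) \<partial>lborel)"
    by (auto simp: tail_def fun_eq_iff intro!: Bochner_Integration.integral_cong)
  have [measurable]: "tail g \<in> borel_measurable borel"
    unfolding t by measurable
  show "(\<lambda>s. indicator {0..} s * s ^ k * tail g s) \<in> borel_measurable lborel"
    by measurable
  have tnn: "0 \<le> tail g s" for s
    using nn by (auto simp: tail_def intro!: integral_nonneg_AE)
  show "AE s in lborel. 0 \<le> indicator {0..} s * s ^ k * tail g s"
    using tnn by (auto split: split_indicator)
  show "0 \<le> half_moment g (Suc k) / Suc k"
    using nn by (auto simp: half_moment_def intro!: divide_nonneg_nonneg integral_nonneg_AE split: split_indicator)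
  \<comment> \<open>With values in \<open>ennreal\<close> the order of integration can be exchanged
    by measurability alone.\<close>
  define h where "h = (\<lambda>s v. ennreal (if 0 \<le> s \<and> s \<le> v then s ^ k * g v else 0))"
  have [measurable]: "case_prod h \<in> borel_measurable (lborel \<Otimes>\<^sub>M lborel)"
    unfolding h_def by measurable
  have "ennreal (indicator {0..} s * s ^ k * tail g s) = (\<integral>\<^sup>+v. h s v \<partial>lborel)" for s
  proof -
    have "ennreal (indicator {0..} s * s ^ k * tail g s)
        = ennreal (\<integral>v. (indicator {0..} s * s ^ k) * (indicator {s..} v * g v) \<partial>lborel)"
      by (simp add: tail_def)
    also have "\<dots> = (\<integral>\<^sup>+v. ennreal ((indicator {0..} s * s ^ k) * (indicator {s..} v * g v)) \<partial>lborel)"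
      using nn g
      by (intro nn_integral_eq_integral[symmetric] integrable_mult_right integrable_indicator_mult)
         (auto split: split_indicator)
    also have "\<dots> = (\<integral>\<^sup>+v. h s v \<partial>lborel)"
      by (auto simp: h_def intro!: nn_integral_cong split: split_indicator)
    finally show ?thesis .
  qed
  then have "(\<integral>\<^sup>+s. ennreal (indicator {0..} s * s ^ k * tail g s) \<partial>lborel)
      = (\<integral>\<^sup>+s. \<integral>\<^sup>+v. h s v \<partial>lborel \<partial>lborel)"
    by simp
  also have "\<dots> = (\<integral>\<^sup>+v. \<integral>\<^sup>+s. h s v \<partial>lborel \<partial>lborel)"
    by (rule lborel_pair.Fubini') measurable
  also have "\<dots> = (\<integral>\<^sup>+v. ennreal (indicator {0..} v * v ^ Suc k * g v / Suc k) \<partial>lborel)"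
  proof (rule nn_integral_cong)
    fix v :: real
    show "(\<integral>\<^sup>+s. h s v \<partial>lborel) = ennreal (indicator {0..} v * v ^ Suc k * g v / Suc k)"
    proof (cases "0 \<le> v")
      case True
      have "(\<integral>\<^sup>+s. h s v \<partial>lborel) = (\<integral>\<^sup>+s. ennreal (s ^ k * g v) * indicator {0..v} s \<partial>lborel)"
        by (auto simp: h_def intro!: nn_integral_cong split: split_indicator)
      also have "\<dots> = ennreal (v ^ Suc k * g v / Suc k - 0 ^ Suc k * g v / Suc k)"
      proof (rule nn_integral_FTC_Icc[OF _ _ _ True])
        fix x :: real
        have "((\<lambda>x. x ^ Suc k * g v / Suc k) has_real_derivative
           (real (Suc k) * x ^ k) * g v / Suc k) (at x)"
          using DERIV_pow[of "Suc k" x] by (intro DERIV_cdivide DERIV_cmult_right) simp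
        then show "((\<lambda>x. x ^ Suc k * g v / Suc k) has_real_derivative x ^ k * g v) (at x)"
          by (simp del: of_nat_Suc)
      qed (use nn in auto)
      finally show ?thesis using True by simp
    next
      case False
      then have "h s v = 0" for s by (auto simp: h_def)
      with False show ?thesis by simp
    qed
  qed
  also have "\<dots> = ennreal (\<integral>v. indicator {0..} v * v ^ Suc k * g v / Suc k \<partial>lborel)"
    using m nn by (intro nn_integral_eq_integral integrable_divide) (auto split: split_indicator)
  also have "\<dots> = ennreal (half_moment g (Suc k) / Suc k)"
    by (simp add: half_moment_def)
  finally show "(\<integral>\<^sup>+s. ennreal (indicator {0..} s * s ^ k * tail g s) \<partial>lborel)
    = ennreal (half_moment g (Suc k) / Suc k)" .
qed

text \<open>The four-point inequality integrated over the increment. It says that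
  \<open>g / tail g\<close> increases, in a product form that stays meaningful where the tail
  vanishes.\<close>

lemma log_concave_hazard_rate:
  assumes g: "log_concave g" "integrable lborel g" and ts: "t \<le> s"
  shows "g t * tail g s \<le> g s * tail g t"
proof -
  have i: "integrable lborel (\<lambda>v. indicator {0..} v * g (x + v))" for x
    using lborel_integrable_real_affine[OF g(2), of 1 x]
    by (intro integrable_indicator_mult) auto
  have "(\<integral>v. g t * (indicator {0..} v * g (s + v)) \<partial>lborel) \<le> (\<integral>v. g s * (indicator {0..} v * g (t + v)) \<partial>lborel)"
  proof (rule integral_mono)
    show "g t * (indicator {0..} v * g (s + v)) \<le> g s * (indicator {0..} v * g (t + v))" for v
      using log_concave_four_point[OF g(1) ts, of v] by (auto simp: mult.commute split: split_indicator)
  qed (use i in auto)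
  then show ?thesis by (simp add: tail_shift)
qed

text \<open>Chebyshev's inequality for \<open>s ^ k\<close> with the weights \<open>g\<close> and
  \<open>tail g\<close>, ordered by the hazard rate; \<open>integral_power_tail\<close> at
  \<open>k\<close> and at 0 evaluates the two tail integrals.\<close>

lemma log_concave_half_moment_step:
  assumes g: "log_concave g" "integrable lborel g"
  shows "half_moment g 0 * half_moment g (Suc k) \<le> Suc k * half_moment g 1 * half_moment g k"
proof -
  note nn = log_concave_nonneg[OF g(1)]
  have m: "integrable lborel (\<lambda>x. indicator {0..} x * x ^ k * g x)" for k
    by (rule log_concave_integrable_half_moment[OF g])
  note t = integral_power_tail[OF nn g(2) m]
  have t0: "has_bochner_integral lborel (\<lambda>s. indicator {0..} s * tail g s) (half_moment g 1)"
    using t[of 0] by simp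
  have t': "has_bochner_integral lborel (\<lambda>s. s ^ k * (indicator {0..} s * tail g s)) (half_moment g (Suc k) / Suc k)" for k
    using t[of k] by (simp add: mult_ac)
  have m': "integrable lborel (\<lambda>s. s ^ k * (indicator {0..} s * g s))"
    using m[of k] by (simp add: mult_ac)
  have m0: "integrable lborel (\<lambda>s. indicator {0..} s * g s)"
    using m[of 0] by simp
  have tail_nn: "0 \<le> tail g s" for s
    using nn by (auto simp: tail_def intro!: integral_nonneg_AE)
  have "(\<integral>s. s ^ k * (indicator {0..} s * tail g s) \<partial>lborel) * (\<integral>s. indicator {0..} s * g s \<partial>lborel)
     \<le> (\<integral>s. s ^ k * (indicator {0..} s * g s) \<partial>lborel) * (\<integral>s. indicator {0..} s * tail g s \<partial>lborel)"
  proof (rule Chebyshev_integral_inequality[OF m0 _ m'])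
    fix s t :: real
    have le: "0 \<le> (s ^ k - t ^ k) * (g s * tail g t - g t * tail g s)"
      if "0 \<le> s" "0 \<le> t" for s t
    proof (cases "t \<le> s")
      case True
      then show ?thesis
        using that log_concave_hazard_rate[OF g True] by (intro mult_nonneg_nonneg) (auto intro: power_mono)
    next
      case False
      then have "s \<le> t" by simp
      then show ?thesis
        using that log_concave_hazard_rate[OF g \<open>s \<le> t\<close>] by (intro mult_nonpos_nonpos) (auto intro: power_mono)
    qed
    show "0 \<le> (s ^ k - t ^ k) * (indicator {0..} s * g s * (indicator {0..} t * tail g t)
        - indicator {0..} t * g t * (indicator {0..} s * tail g s))"
      using le[of s t] by (auto split: split_indicator)
  qed (use t0 t' in \<open>auto simp: has_bochner_integral_iff\<close>)
  then have "half_moment g (Suc k) / Suc k * half_moment g 0 \<le> half_moment g k * half_moment g 1"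
    using t0 t'[of k] by (simp add: has_bochner_integral_iff half_moment_def mult_ac)
  then show ?thesis by (simp add: field_simps del: of_nat_Suc)
qed

section \<open>Absolute moments from the two half-lines\<close>

lemma log_concave_integrable_moment:
  assumes g: "log_concave g" "integrable lborel g"
  shows "integrable lborel (\<lambda>x. \<bar>x\<bar> ^ k * g x)"
proof (rule Bochner_Integration.integrable_bound)
  have [measurable]: "g \<in> borel_measurable borel"
    using g(2) borel_measurable_integrable by force
  have *: "log_concave (\<lambda>x. g (- x))" "integrable lborel (\<lambda>x. g (- x))"
    by (rule log_concave_reflect[OF g(1)] lborel_integrable_reflect[OF g(2)])+
  have "integrable lborel (\<lambda>x. indicator {0..} (- x) * (- x) ^ k * g x)"
    using lborel_integrable_real_affine[OF log_concave_integrable_half_moment[OF *, of k], of "-1" 0] by simp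
  then show "integrable lborel (\<lambda>x. indicator {0..} x * x ^ k * g x + indicator {0..} (- x) * (- x) ^ k * g x)"
    using log_concave_integrable_half_moment[OF g, of k] by simp
  \<comment> \<open>Only a bound: for \<open>k = 0\<close> the origin is counted in both
    halves.\<close>
  show "AE x in lborel. norm (\<bar>x\<bar> ^ k * g x)
      \<le> norm (indicator {0..} x * x ^ k * g x + indicator {0..} (- x) * (- x) ^ k * g x)"
    using log_concave_nonneg[OF g(1)] by (intro AE_I2) (auto simp: abs_mult power_abs split: split_indicator)
  show "(\<lambda>x. \<bar>x\<bar> ^ k * g x) \<in> borel_measurable lborel"
    by measurable
qed

lemma log_concave_moment_split:
  assumes g: "log_concave g" "integrable lborel g"
  shows "(\<integral>x. \<bar>x\<bar> ^ k * g x \<partial>lborel) = half_moment g k + half_moment (\<lambda>x. g (- x)) k"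
    and "(\<integral>x. x * g x \<partial>lborel) = half_moment g 1 - half_moment (\<lambda>x. g (- x)) 1"
proof -
  have [measurable]: "g \<in> borel_measurable borel"
    using g(2) borel_measurable_integrable by force
  have *: "log_concave (\<lambda>x. g (- x))" "integrable lborel (\<lambda>x. g (- x))"
    by (rule log_concave_reflect[OF g(1)] lborel_integrable_reflect[OF g(2)])+
  have m: "integrable lborel (\<lambda>x. indicator {0..} x * x ^ k * g x)" for k
    by (rule log_concave_integrable_half_moment[OF g])
  have m': "integrable lborel (\<lambda>x. indicator {0..} (- x) * (- x) ^ k * g x)" for k
    using lborel_integrable_real_affine[OF log_concave_integrable_half_moment[OF *, of k], of "-1" 0] by simp
  have h': "half_moment (\<lambda>x. g (- x)) k = (\<integral>x. indicator {0..} (- x) * (- x) ^ k * g x \<partial>lborel)" for k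
    unfolding half_moment_def
    by (subst lborel_integral_real_affine[where c = "-1" and t = 0]) auto
  \<comment> \<open>The double count of the origin at \<open>k = 0\<close> is harmless, as a point
    is a null set.\<close>
  have "(\<integral>x. \<bar>x\<bar> ^ k * g x \<partial>lborel)
      = (\<integral>x. indicator {0..} x * x ^ k * g x + indicator {0..} (- x) * (- x) ^ k * g x \<partial>lborel)"
    using AE_lborel_singleton[of "0 :: real"]
    by (intro integral_cong_AE) (measurable, auto split: split_indicator)
  also have "\<dots> = half_moment g k + half_moment (\<lambda>x. g (- x)) k"
    using m m' by (simp add: h' half_moment_def)
  finally show "(\<integral>x. \<bar>x\<bar> ^ k * g x \<partial>lborel) = half_moment g k + half_moment (\<lambda>x. g (- x)) k" .
  have "(\<integral>x. x * g x \<partial>lborel)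
      = (\<integral>x. indicator {0..} x * x ^ 1 * g x - indicator {0..} (- x) * (- x) ^ 1 * g x \<partial>lborel)"
    by (intro Bochner_Integration.integral_cong) (auto split: split_indicator)
  also have "\<dots> = half_moment g 1 - half_moment (\<lambda>x. g (- x)) 1"
    unfolding h' half_moment_def by (rule Bochner_Integration.integral_diff[OF m m'])
  finally show "(\<integral>x. x * g x \<partial>lborel) = half_moment g 1 - half_moment (\<lambda>x. g (- x)) 1" .
qed

section \<open>Growth of the excess function\<close>

text \<open>The mean residual life \<open>excess g x / tail g x\<close> decreases in
  \<open>x\<close>: Chebyshev's inequality for the identity function and the translates of
  \<open>g\<close> by \<open>a\<close> and \<open>b\<close>, whose ratio is monotone by the
  four-point inequality.\<close>

lemma log_concave_excess_tail:
  assumes g: "log_concave g" "integrable lborel g" and ab: "a \<le> b"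
  shows "excess g b * tail g a \<le> excess g a * tail g b"
proof -
  have c: "log_concave (\<lambda>v. g (x + v))" "integrable lborel (\<lambda>v. g (x + v))" for x
    using log_concave_affine[OF g(1), of x 1] lborel_integrable_real_affine[OF g(2), of 1 x] by auto
  have i: "integrable lborel (\<lambda>v. indicator {0..} v * g (x + v))"
    and i': "integrable lborel (\<lambda>v. v * (indicator {0..} v * g (x + v)))" for x
    using log_concave_integrable_half_moment[OF c, of 0 x] log_concave_integrable_half_moment[OF c, of 1 x]
    by (simp_all add: mult_ac)
  have pt: "g (a + t) * g (b + s) \<le> g (a + s) * g (b + t)" if "t \<le> s" for s t
    using log_concave_four_point[OF g(1), of "a + t" "b + t" "s - t"] that ab by (simp add: add_ac)
  show ?thesis
    unfolding excess_shift tail_shift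
  proof (rule Chebyshev_integral_inequality[OF i i i' i'])
    fix s t :: real
    have "0 \<le> (s - t) * (g (a + s) * g (b + t) - g (a + t) * g (b + s))"
    proof (cases "t \<le> s")
      case True
      then show ?thesis using pt[OF True] by (intro mult_nonneg_nonneg) auto
    next
      case False
      then show ?thesis using pt[of s t] by (intro mult_nonpos_nonpos) (auto simp: mult.commute)
    qed
    then show "0 \<le> (s - t) * (indicator {0..} s * g (a + s) * (indicator {0..} t * g (b + t))
        - indicator {0..} t * g (a + t) * (indicator {0..} s * g (b + s)))"
      by (auto split: split_indicator)
  qed
qed

lemma integrable_excess:
  fixes g :: "real \<Rightarrow> real"
  assumes "integrable lborel g" "integrable lborel (\<lambda>v. v * g v)"
  shows "integrable lborel (\<lambda>v. indicator {x..} v * (v - x) * g v)"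
proof -
  have "integrable lborel (\<lambda>v. indicator {x..} v * (v * g v - x * g v))"
    using assms by (intro integrable_indicator_mult) auto
  then show ?thesis by (simp add: algebra_simps)
qed

text \<open>For \<open>v \<ge> x\<close>, the difference \<open>v - x\<close> is at most
  \<open>y - x\<close> plus the positive part of \<open>v - y\<close>. This finite difference
  replaces differentiation of \<open>excess\<close>.\<close>

lemma excess_decrease:
  assumes nn: "\<And>x. 0 \<le> g x" and g: "integrable lborel g" "integrable lborel (\<lambda>v. v * g v)"
    and xy: "x \<le> y"
  shows "excess g x \<le> excess g y + (y - x) * tail g x"
proof -
  note i = integrable_excess[OF g]
  have t: "integrable lborel (\<lambda>v. indicator {x..} v * g v)"
    using g(1) by (intro integrable_indicator_mult) auto
  have "excess g x \<le> (\<integral>v. indicator {y..} v * (v - y) * g v + (y - x) * (indicator {x..} v * g v) \<partial>lborel)"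
    unfolding excess_def
  proof (rule integral_mono)
    show "indicator {x..} v * (v - x) * g v
      \<le> indicator {y..} v * (v - y) * g v + (y - x) * (indicator {x..} v * g v)" for v
      using xy nn[of v] by (auto simp: algebra_simps mult_right_mono split: split_indicator)
  qed (use i t in auto)
  also have "\<dots> = excess g y + (y - x) * tail g x"
    using i t by (simp add: excess_def tail_def)
  finally show ?thesis .
qed

text \<open>A positive part dominates the quantity itself, and \<open>v - x\<close> has mean
  \<open>- x\<close>.\<close>

lemma excess_ge:
  assumes nn: "\<And>x. 0 \<le> g x" and g: "integrable lborel g" "integrable lborel (\<lambda>v. v * g v)"
    and "(\<integral>v. g v \<partial>lborel) = 1" "(\<integral>v. v * g v \<partial>lborel) = 0"
  shows "- x \<le> excess g x"
proof -
  have "- x = (\<integral>v. v * g v - x * g v \<partial>lborel)"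
    using assms by simp
  also have "\<dots> \<le> excess g x"
    unfolding excess_def
  proof (rule integral_mono)
    show "v * g v - x * g v \<le> indicator {x..} v * (v - x) * g v" for v
      using nn[of v] by (auto simp: algebra_simps mult_right_mono split: split_indicator)
  qed (use g integrable_excess[OF g] in auto)
  finally show ?thesis .
qed

section \<open>Lower bound for the mass right of the mean\<close>

text \<open>The sharp constant is \<^term>\<open>exp (-1)\<close> (Gruenbaum), the limit of
  \<open>(1 - 1 / n) ^ n\<close>; the value at \<open>n = 10\<close> already exceeds \<open>ln 2 / 2\<close>.\<close>
lemma log_concave_mean_quantile:
  assumes g: "log_concave g" "integrable lborel g"
    and one: "(\<integral>v. g v \<partial>lborel) = 1" and mean: "(\<integral>v. v * g v \<partial>lborel) = 0"
    and r: "0 < half_moment g 1"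
  shows "(9 / 10) ^ 10 \<le> half_moment g 0"
proof -
  note nn = log_concave_nonneg[OF g(1)]
  have [measurable]: "g \<in> borel_measurable borel"
    using g(2) borel_measurable_integrable by force
  have vg: "integrable lborel (\<lambda>v. v * g v)"
    using log_concave_integrable_moment[OF g, of 1]
    by (rule Bochner_Integration.integrable_bound) (auto simp: abs_mult)
  define p r where "p = tail g 0" and "r = excess g 0"
  have p_eq: "p = half_moment g 0" and r_eq: "r = half_moment g 1"
    by (simp_all add: p_def r_def tail_def excess_def half_moment_def)
  have p: "0 < p"
  proof -
    have "0 \<le> p" using nn by (auto simp: p_def tail_def intro!: integral_nonneg_AE)
    moreover have "p \<noteq> 0"
    proof
      \<comment> \<open>Zero mass on the half-line would make \<open>g\<close> vanish almost
        everywhere there, hence also the first half-moment.\<close>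
      assume "p = 0"
      then have "AE v in lborel. indicator {0..} v * g v = 0"
        using integral_nonneg_eq_0_iff_AE[of lborel "\<lambda>v. indicator {0..} v * g v"]
          integrable_indicator_mult[OF g(2), of "{0..}"] nn
        by (simp add: p_def tail_def)
      then have "half_moment g 1 = 0"
        unfolding half_moment_def by (intro integral_eq_zero_AE) auto
      then show False using r by simp
    qed
    ultimately show ?thesis by simp
  qed
  \<comment> \<open>Ten steps of length \<open>d\<close> lead from 0 to \<open>- r / p\<close>, and
    each retains at least nine tenths of the excess.\<close>
  define d where "d = r / (10 * p)"
  have d: "0 < d" using p r by (simp add: d_def r_eq)
  have step: "9 / 10 * excess g x \<le> excess g (x + d)" if "x \<le> 0" for x
  proof -
    \<comment> \<open>Monotonicity of the mean residual life between \<open>x\<close> and 0 bounds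
      the tail at \<open>x\<close> by the excess there.\<close>
    have "r * tail g x \<le> excess g x * p"
      using log_concave_excess_tail[OF g that] by (simp add: p_def r_def)
    then have "d * tail g x \<le> excess g x / 10"
      using p by (simp add: d_def field_simps)
    then show ?thesis
      using excess_decrease[OF nn g(2) vg, of x "x + d"] d by simp
  qed
  have iter: "(9 / 10) ^ n * excess g (- (n * d)) \<le> r" for n :: nat
  proof (induction n)
    case (Suc n)
    have "9 / 10 * excess g (- (Suc n * d)) \<le> excess g (- (Suc n * d) + d)"
      using d by (intro step) simp
    also have "- (Suc n * d) + d = - (n * d)" by (simp add: algebra_simps)
    finally have "(9 / 10) ^ n * (9 / 10 * excess g (- (Suc n * d))) \<le> (9 / 10) ^ n * excess g (- (n * d))"
      by (intro mult_left_mono) auto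
    also note Suc.IH
    finally show ?case by (simp only: power_Suc2 mult.assoc)
  qed (simp add: r_def)
  have "10 * d = r / p" using p by (simp add: d_def)
  \<comment> \<open>At \<open>- r / p\<close> the excess is at least \<open>r / p\<close>, while ten
    steps cap its \<open>(9 / 10) ^ 10\<close> multiple by \<open>r\<close>; cancelling
    \<open>r\<close> leaves the bound on \<open>p\<close>.\<close>
  then have "(9 / 10) ^ 10 * (r / p) \<le> (9 / 10) ^ 10 * excess g (- (10 * d))"
    using excess_ge[OF nn g(2) vg one mean, of "- (10 * d)"] by (intro mult_left_mono) auto
  also have "\<dots> \<le> r" using iter[of 10] by simp
  finally have "(9 / 10) ^ 10 * r \<le> r * p" using p by (simp only: pos_divide_le_eq times_divide_eq_right)
  then have "r * (9 / 10) ^ 10 \<le> r * p" by (simp only: mult.commute)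
  then show ?thesis using r by (simp only: mult_le_cancel_left_pos p_eq r_eq)
qed

section \<open>Moment recursion for centred densities\<close>

text \<open>The factor \<open>half_moment g 0\<close> in the half-moment step is replaced by its
  lower bound \<open>ln 2 / 2\<close>.\<close>

lemma log_concave_centered_half_moment_step:
  assumes g: "log_concave g" "integrable lborel g"
    and one: "(\<integral>v. g v \<partial>lborel) = 1" and mean: "(\<integral>v. v * g v \<partial>lborel) = 0"
    and r: "0 < half_moment g 1"
  shows "half_moment g (Suc k) \<le> Suc k * (2 / ln 2 * half_moment g 1) * half_moment g k"
proof -
  \<comment> \<open>Numerically \<open>25 / 72\<close> is about 0.3472 and
    \<open>(9 / 10) ^ 10\<close> about 0.3487; ten is the least \<open>n\<close> for which
    \<open>(1 - 1 / n) ^ n\<close> exceeds \<open>ln 2 / 2\<close>.\<close>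
  have "ln 2 / 2 \<le> (25 / 36 :: real) / 2" using ln2_le_25_over_36 by simp
  also have "\<dots> \<le> (9 / 10) ^ 10" by (simp add: power_divide)
  also have "\<dots> \<le> half_moment g 0" by (rule log_concave_mean_quantile[OF assms])
  finally have p: "ln 2 / 2 \<le> half_moment g 0" .
  have hm: "0 \<le> half_moment g k" for k
    using log_concave_nonneg[OF g(1)]
    by (auto simp: half_moment_def intro!: integral_nonneg_AE split: split_indicator)
  have "ln 2 / 2 * half_moment g (Suc k) \<le> half_moment g 0 * half_moment g (Suc k)"
    using p hm by (intro mult_right_mono)
  also have "\<dots> \<le> Suc k * half_moment g 1 * half_moment g k"
    by (rule log_concave_half_moment_step[OF g])
  finally show ?thesis by (simp add: field_simps del: of_nat_Suc)
qed

text \<open>Mean zero equates the first half-moments of \<open>g\<close> and of its reflection, so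
  both halves satisfy the recursion with the same constant \<open>L\<close> and can be
  added.\<close>

lemma log_concave_centered_moment_step:
  fixes L :: real
  assumes g: "log_concave g" "integrable lborel g"
    and one: "(\<integral>v. g v \<partial>lborel) = 1" and mean: "(\<integral>v. v * g v \<partial>lborel) = 0"
  defines "L \<equiv> 1 / ln 2 * (\<integral>v. \<bar>v\<bar> * g v \<partial>lborel)"
  shows "0 < L"
    and "(\<integral>v. \<bar>v\<bar> ^ Suc k * g v \<partial>lborel) \<le> Suc k * L * (\<integral>v. \<bar>v\<bar> ^ k * g v \<partial>lborel)"
proof -
  note nn = log_concave_nonneg[OF g(1)]
  define g' where "g' = (\<lambda>x. g (- x))"
  have g': "log_concave g'" "integrable lborel g'"
    unfolding g'_def by (rule log_concave_reflect[OF g(1)] lborel_integrable_reflect[OF g(2)])+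
  have one': "(\<integral>v. g' v \<partial>lborel) = 1"
    using one lborel_integral_real_affine[of "-1" g 0] by (simp add: g'_def)
  have mean': "(\<integral>v. v * g' v \<partial>lborel) = 0"
    using mean lborel_integral_real_affine[of "-1" "\<lambda>v. v * g v" 0] by (simp add: g'_def)
  have split: "(\<integral>v. \<bar>v\<bar> ^ k * g v \<partial>lborel) = half_moment g k + half_moment g' k" for k
    using log_concave_moment_split(1)[OF g] by (simp add: g'_def)
  have eq: "half_moment g' 1 = half_moment g 1"
    using log_concave_moment_split(2)[OF g] mean by (simp add: g'_def)
  have m1: "(\<integral>v. \<bar>v\<bar> * g v \<partial>lborel) = 2 * half_moment g 1"
    using split[of 1] eq by simp
  \<comment> \<open>A vanishing first absolute moment would make \<open>g\<close> zero away from the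
    origin almost everywhere, against total mass 1.\<close>
  have "(\<integral>v. \<bar>v\<bar> * g v \<partial>lborel) \<noteq> 0"
  proof
    assume "(\<integral>v. \<bar>v\<bar> * g v \<partial>lborel) = 0"
    then have "AE v in lborel. \<bar>v\<bar> * g v = 0"
      using integral_nonneg_eq_0_iff_AE[of lborel "\<lambda>v. \<bar>v\<bar> * g v"]
        log_concave_integrable_moment[OF g, of 1] nn by simp
    then have "AE v in lborel. g v = 0"
      using AE_lborel_singleton[of 0] by eventually_elim simp
    then have "(\<integral>v. g v \<partial>lborel) = 0"
      by (rule integral_eq_zero_AE)
    then show False using one by simp
  qed
  moreover have "0 \<le> (\<integral>v. \<bar>v\<bar> * g v \<partial>lborel)"
    using nn by (intro integral_nonneg_AE) auto
  ultimately have pos: "0 < (\<integral>v. \<bar>v\<bar> * g v \<partial>lborel)" by simp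
  then show "0 < L" by (simp add: L_def)
  have r: "0 < half_moment g 1" using pos m1 by simp
  have L: "L = 2 / ln 2 * half_moment g 1" by (simp add: L_def m1)
  show "(\<integral>v. \<bar>v\<bar> ^ Suc k * g v \<partial>lborel) \<le> Suc k * L * (\<integral>v. \<bar>v\<bar> ^ k * g v \<partial>lborel)"
    using log_concave_centered_half_moment_step[OF g one mean r, of k]
      log_concave_centered_half_moment_step[OF g' one' mean', of k] r
    unfolding split L eq by (simp add: distrib_left)
qed

section \<open>Transfer to the random variable\<close>

theorem corollary7p3:
  fixes M :: "'a measure" and X :: "'a \<Rightarrow> real" and f :: "real \<Rightarrow> real" and L :: real
  assumes "prob_space M"
    and "distributed M lborel X (\<lambda>x. ennreal (f x))"
    and "log_concave f"
    and "L = 1 / ln 2 * (\<integral>\<omega>. \<bar>X \<omega> - (\<integral>\<omega>'. X \<omega>' \<partial>M)\<bar> \<partial>M)"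
  shows "central_moment_bounded M X L \<and> L \<le> 2 / ln 2 * (\<integral>\<omega>. \<bar>X \<omega>\<bar> \<partial>M)"
proof -
  interpret prob_space M by fact
  note D = assms(2) and f = assms(3) and nn = log_concave_nonneg[OF assms(3)]
  have [measurable]: "f \<in> borel_measurable borel"
    using distributed_real_measurable[OF _ D] nn by simp
  have dint: "integrable M (\<lambda>\<omega>. h (X \<omega>)) \<longleftrightarrow> integrable lborel (\<lambda>x. f x * h x)"
    and deq: "expectation (\<lambda>\<omega>. h (X \<omega>)) = (\<integral>x. f x * h x \<partial>lborel)"
    if "h \<in> borel_measurable borel" for h :: "real \<Rightarrow> real"
    using distributed_integrable[OF D, of h] distributed_integral[OF D, of h] that nn by simp_all
  have fint: "integrable lborel f" and f1: "(\<integral>x. f x \<partial>lborel) = 1"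
    using dint[of "\<lambda>_. 1"] deq[of "\<lambda>_. 1"] by (simp_all add: prob_space)
  define \<mu> where "\<mu> = expectation X"
  \<comment> \<open>The density of \<open>X - \<mu>\<close>.\<close>
  define g where "g = (\<lambda>v. f (\<mu> + v))"
  have g: "log_concave g" "integrable lborel g"
    using log_concave_affine[OF f, of \<mu> 1] lborel_integrable_real_affine[OF fint, of 1 \<mu>]
    by (auto simp: g_def)
  have g1: "(\<integral>v. g v \<partial>lborel) = 1"
    using lborel_integral_real_affine[of 1 f \<mu>] f1 by (simp add: g_def)
  \<comment> \<open>Exponential decay of \<open>f\<close> itself gives this; hence
    \<open>\<mu>\<close> is a genuine mean and not the default value 0 of a divergent
    integral.\<close>
  have absX: "integrable M (\<lambda>\<omega>. \<bar>X \<omega>\<bar>)"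
    using dint[of abs] log_concave_integrable_moment[OF f fint, of 1] by (simp add: mult.commute)
  have X: "integrable M X"
    using absX distributed_measurable[OF D] by (subst (asm) integrable_abs_iff) auto
  have shift: "expectation (\<lambda>\<omega>. h (X \<omega> - \<mu>)) = (\<integral>v. h v * g v \<partial>lborel)"
    and shift_int: "integrable M (\<lambda>\<omega>. h (X \<omega> - \<mu>)) \<longleftrightarrow> integrable lborel (\<lambda>v. h v * g v)"
    if [measurable]: "h \<in> borel_measurable borel" for h :: "real \<Rightarrow> real"
    using deq[of "\<lambda>x. h (x - \<mu>)"] lborel_integral_real_affine[of 1 "\<lambda>x. f x * h (x - \<mu>)" \<mu>]
      dint[of "\<lambda>x. h (x - \<mu>)"] lborel_integrable_real_affine_iff[of 1 "\<lambda>x. f x * h (x - \<mu>)" \<mu>]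
    by (simp_all add: g_def mult.commute)
  have g0: "(\<integral>v. v * g v \<partial>lborel) = 0"
    using shift[of "\<lambda>v. v"] X by (simp add: \<mu>_def prob_space)
  have moment: "expectation (\<lambda>\<omega>. \<bar>X \<omega> - \<mu>\<bar> ^ i) = (\<integral>v. \<bar>v\<bar> ^ i * g v \<partial>lborel)" for i
    by (rule shift) measurable
  have L: "L = 1 / ln 2 * (\<integral>v. \<bar>v\<bar> * g v \<partial>lborel)"
    using moment[of 1] assms(4) by (simp add: \<mu>_def)
  have "integrable M (\<lambda>\<omega>. \<bar>X \<omega> - \<mu>\<bar> ^ i)" for i
    using shift_int[of "\<lambda>v. \<bar>v\<bar> ^ i"] log_concave_integrable_moment[OF g] by simp
  moreover have "expectation (\<lambda>\<omega>. \<bar>X \<omega> - \<mu>\<bar> ^ i) \<le> real i * L * expectation (\<lambda>\<omega>. \<bar>X \<omega> - \<mu>\<bar> ^ (i - 1))"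
    if "1 \<le> i" for i :: nat
    using log_concave_centered_moment_step(2)[OF g g1 g0, of "i - 1"] that
    unfolding moment L by simp
  moreover have "0 < L"
    using log_concave_centered_moment_step(1)[OF g g1 g0] by (simp add: L)
  ultimately have "central_moment_bounded M X L"
    using X by (simp add: central_moment_bounded_def \<mu>_def)
  moreover have "expectation (\<lambda>\<omega>. \<bar>X \<omega> - \<mu>\<bar>) \<le> 2 * expectation (\<lambda>\<omega>. \<bar>X \<omega>\<bar>)"
  proof -
    have "expectation (\<lambda>\<omega>. \<bar>X \<omega> - \<mu>\<bar>) \<le> expectation (\<lambda>\<omega>. \<bar>X \<omega>\<bar> + \<bar>\<mu>\<bar>)"
      using X absX by (intro integral_mono) auto
    also have "\<dots> = expectation (\<lambda>\<omega>. \<bar>X \<omega>\<bar>) + \<bar>\<mu>\<bar>"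
      using absX by (simp add: prob_space)
    also have "\<bar>\<mu>\<bar> \<le> expectation (\<lambda>\<omega>. \<bar>X \<omega>\<bar>)"
      unfolding \<mu>_def by (rule integral_abs_bound)
    finally show ?thesis by simp
  qed
  then have "L \<le> 2 / ln 2 * expectation (\<lambda>\<omega>. \<bar>X \<omega>\<bar>)"
    using assms(4) by (simp add: \<mu>_def divide_right_mono)
  ultimately show ?thesis by simp
qed

end
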